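(* The function $d\mapsto\gamma(d)$, defined for integers $d\ge 2$ by \[ \gamma(d)=\frac{2^{d-2}d^2\,\Gamma(d/2)^2}{\bigl(j_{\frac{d-2}{2},1}\bigr)^d}, \] is monotonically decreasing, i.e. $\gamma(d+1)\le\gamma(d)$ for every integer $d\ge 2$.
   Context: $\Gamma$ is the Gamma function and $j_{\nu,1}$ denotes the first positive zero of the Bessel function of the first kind $J_\nu$. Equivalently, $\gamma(d)=C_d^{-1}(\lambda_1(\mathbb{B}_1^d))^{-d/2}$, where $C_d=(2\pi)^{-d}\omega_d$, $\omega_d$ is the volume of the unit ball in $\mathbb{R}^d$, and $\lambda_1(\mathbb{B}_1^d)$ is the lowest Dirichlet eigenvalue of the Laplacian in the ball of volume $1$ in $\mathbb{R}^d$. *)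

theory Defs
  imports "HOL-Analysis.Analysis"
begin

text \<open>
  Bessel function of the first kind of real order \<open>\<nu>\<close>, by its defining series, for
  arguments \<open>x > 0\<close> (outside this range \<open>powr\<close> does not give the usual values).
  The factor \<open>rGamma\<close> is the reciprocal \<open>1 / \<Gamma>\<close>, extended by 0 to the poles of \<open>\<Gamma>\<close>.
\<close>

definition Bessel_J :: "real \<Rightarrow> real \<Rightarrow> real" where
  "Bessel_J \<nu> x =
     (\<Sum>m. (-1) ^ m * rGamma (real m + \<nu> + 1) / fact m * (x / 2) powr (2 * real m + \<nu>))"

definition Bessel_J_first_zero :: "real \<Rightarrow> real" where
  "Bessel_J_first_zero \<nu> = (LEAST x. 0 < x \<and> Bessel_J \<nu> x = 0)"

text \<open>Only meant for \<open>d \<ge> 2\<close>, where the natural-number subtraction \<open>d - 2\<close> does not truncate.\<close>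

definition gamma_const :: "nat \<Rightarrow> real" where
  "gamma_const d =
     2 ^ (d - 2) * (real d)\<^sup>2 * (Gamma (real d / 2))\<^sup>2 / Bessel_J_first_zero ((real d - 2) / 2) ^ d"

end

theory Submission
  imports Defs
begin

text \<open>
  Put \<open>\<nu> = d/2 - 1\<close>, \<open>\<mu> = \<nu> + 1/2\<close>, and write \<open>Y\<close>, \<open>Y'\<close> for the squares of the first zeros of
  \<open>J\<^sub>\<nu>\<close> and \<open>J\<^sub>\<mu>\<close>.  Since \<open>\<gamma>(d) = 2\<^sup>d \<Gamma>(d/2 + 1)\<^sup>2 / j\<^sub>\<nu>\<^sup>d\<close>, the claim only involves a quotient of
  two values of \<open>\<Gamma>\<close> and the growth from \<open>Y\<close> to \<open>Y'\<close>.  The sharp estimate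
  \<open>(\<Gamma>(x + 1/2) / \<Gamma>(x))\<^sup>4 \<le> x\<^sup>2 - x/2 + 1/8\<close> of \<open>Gamma_quotient_power4_le\<close> reduces it to
  \<open>(d\<^sup>2 + 3d + 5/2) Y\<^sup>d \<le> Y'\<^sup>d\<^sup>+\<^sup>1\<close>.

  Neither zero has to be located precisely: for large \<open>d\<close> it is the increment \<open>Y' - Y\<close> that counts,
  because the quotient \<open>Y'/Y\<close> enters with the power \<open>d + 1\<close>.  In the variable \<open>t = ln x\<close> the Bessel
  equation becomes \<open>y'' = (\<nu>\<^sup>2 - e\<^sup>2\<^sup>t) y\<close>, and the substitution \<open>x \<mapsto> k x\<^sup>\<alpha>\<close> becomes affine.  A Sturm
  comparison of \<open>J\<^sub>\<nu>(x)\<close> with \<open>J\<^sub>\<mu>(k x\<^sup>\<alpha>)\<close>, with \<open>\<alpha> < 1\<close> nearly optimal, gives with \<open>a = \<mu>\<^sup>2 - \<nu>\<^sup>2\<close>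
  \<open>Y' \<ge> Y + 3a (Y + a) / (Y + 3\<mu>\<^sup>2 - \<nu>\<^sup>2)\<close>
  (\<open>Bessel_J_first_zero_square_increment\<close>).  Taking \<open>\<alpha> = 1\<close> would only give \<open>Y' - \<mu>\<^sup>2 \<ge> Y - \<nu>\<^sup>2\<close>, which
  is too weak for small \<open>d\<close>.

  For \<open>d \<ge> 4\<close> the increment, with the crude bounds \<open>j\<^sub>\<nu> \<ge> \<nu>\<close> and \<open>j\<^sub>\<nu>\<^sup>2 \<ge> 6(\<nu> + 1)\<close>, suffices; after
  passing to logarithms what is left is a polynomial inequality.  For \<open>d = 2\<close> and \<open>d = 3\<close> the
  increment bound falls short, but there the truncated power series bound the zeros well enough.
\<close>

section \<open>The power series behind the Bessel function\<close>

text \<open>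
  The entire function \<open>C\<^sub>\<nu>\<close> (Bessel-Clifford function, with alternating signs) for which
  \<open>J\<^sub>\<nu>(x) = (x/2)\<^sup>\<nu> C\<^sub>\<nu>(x\<^sup>2/4)\<close>.  Separating off the power of \<open>x\<close> makes the theory of power series
  applicable for non-integer orders as well.
\<close>

definition Bessel_Clifford :: "real \<Rightarrow> real \<Rightarrow> real" where
  "Bessel_Clifford \<nu> z = (\<Sum>m. (-1) ^ m * rGamma (real m + \<nu> + 1) / fact m * z ^ m)"

lemma rGamma_pos: "rGamma x > 0" if "x > 0" for x :: real
  using that by (simp add: rGamma_inverse_Gamma)

lemma rGamma_shift_le:
  fixes \<nu> :: real
  assumes "\<nu> \<ge> 0"
  shows "rGamma (real m + \<nu> + 1) \<le> rGamma (\<nu> + 1)"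
proof (induction m)
  case (Suc m)
  have "rGamma (real (Suc m) + \<nu> + 1) \<le> (real m + \<nu> + 1) * rGamma (real m + \<nu> + 1 + 1)"
    using assms rGamma_pos[of "real m + \<nu> + 1 + 1"]
    by (simp add: algebra_simps mult_nonneg_nonneg add_nonneg_nonneg)
  also have "\<dots> = rGamma (real m + \<nu> + 1)" by (rule rGamma_plus1)
  finally show ?case using Suc.IH by linarith
qed simp

lemma Bessel_Clifford_summable:
  assumes "\<nu> \<ge> 0"
  shows "summable (\<lambda>m. (-1) ^ m * rGamma (real m + \<nu> + 1) / fact m * (z::real) ^ m)"
proof (rule summable_comparison_test)
  show "summable (\<lambda>m. rGamma (\<nu> + 1) * (inverse (fact m) * \<bar>z\<bar> ^ m))"
    by (intro summable_mult summable_exp)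
  show "\<exists>N. \<forall>m\<ge>N. norm ((-1) ^ m * rGamma (real m + \<nu> + 1) / fact m * z ^ m)
          \<le> rGamma (\<nu> + 1) * (inverse (fact m) * \<bar>z\<bar> ^ m)"
  proof (intro exI allI impI)
    fix m :: nat
    have "norm ((-1) ^ m * rGamma (real m + \<nu> + 1) / fact m * z ^ m)
            = rGamma (real m + \<nu> + 1) * (inverse (fact m) * \<bar>z\<bar> ^ m)"
      using assms rGamma_pos[of "real m + \<nu> + 1"]
      by (simp add: abs_mult power_abs divide_inverse)
    also have "\<dots> \<le> rGamma (\<nu> + 1) * (inverse (fact m) * \<bar>z\<bar> ^ m)"
      by (intro mult_right_mono rGamma_shift_le assms) auto
    finally show "norm ((-1) ^ m * rGamma (real m + \<nu> + 1) / fact m * z ^ m)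
          \<le> rGamma (\<nu> + 1) * (inverse (fact m) * \<bar>z\<bar> ^ m)" .
  qed
qed

lemma Bessel_Clifford_0: "Bessel_Clifford \<nu> 0 = rGamma (\<nu> + 1)"
  unfolding Bessel_Clifford_def by (subst powser_zero) simp

text \<open>
  Differentiating shifts the coefficients by one, and a shift of \<open>m\<close> in \<open>\<Gamma>(m + \<nu> + 1)\<close> is the same as
  a shift of the order.
\<close>

lemma DERIV_Bessel_Clifford:
  assumes "\<nu> \<ge> 0"
  shows "(Bessel_Clifford \<nu> has_real_derivative - Bessel_Clifford (\<nu> + 1) z) (at z)"
proof -
  define c where "c m = (-1) ^ m * rGamma (real m + \<nu> + 1) / fact m" for m
  have "((\<lambda>z. \<Sum>m. c m * z ^ m) has_real_derivative (\<Sum>m. diffs c m * z ^ m)) (at z)"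
    unfolding c_def
    by (rule termdiffs_strong_converges_everywhere) (rule Bessel_Clifford_summable[OF assms])
  moreover have "diffs c m * z ^ m
      = - ((-1) ^ m * rGamma (real m + (\<nu> + 1) + 1) / fact m * z ^ m)" for m
    by (simp add: diffs_def c_def add_ac del: of_nat_Suc) (simp add: add_ac)
  moreover have "Bessel_Clifford \<nu> = (\<lambda>z. \<Sum>m. c m * z ^ m)"
    by (simp add: fun_eq_iff Bessel_Clifford_def c_def)
  ultimately show ?thesis
    using Bessel_Clifford_summable[of "\<nu> + 1" z] assms
    by (simp add: Bessel_Clifford_def suminf_minus)
qed

text \<open>
  Coefficientwise this is \<open>1/\<Gamma>(m + \<nu> + 1) = ((\<nu> + 1) + m) / \<Gamma>(m + \<nu> + 2)\<close>; the summand with the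
  factor \<open>m\<close> cancels against \<open>m!\<close> and produces the shifted series.
\<close>

lemma Bessel_Clifford_recurrence:
  assumes "\<nu> \<ge> 0"
  shows "Bessel_Clifford \<nu> z = (\<nu> + 1) * Bessel_Clifford (\<nu> + 1) z - z * Bessel_Clifford (\<nu> + 2) z"
proof -
  define c where "c \<nu> m = (-1) ^ m * rGamma (real m + \<nu> + 1) / fact m" for \<nu> :: real and m
  have s: "summable (\<lambda>m. c \<mu> m * z ^ m)" if "\<mu> \<ge> 0" for \<mu>
    unfolding c_def by (rule Bessel_Clifford_summable[OF that])
  have c0: "c \<nu> 0 = (\<nu> + 1) * c (\<nu> + 1) 0"
    using rGamma_plus1[of "\<nu> + 1"] by (simp add: c_def add_ac)
  have cS: "c \<nu> (Suc m) = (\<nu> + 1) * c (\<nu> + 1) (Suc m) - c (\<nu> + 2) m" for m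
  proof -
    define R where "R = rGamma (real m + \<nu> + 3)"
    have "(real m + \<nu> + 2) * R = rGamma (real m + \<nu> + 2)"
      unfolding R_def using rGamma_plus1[of "real m + \<nu> + 2"] by (simp add: add_ac)
    then have "c \<nu> (Suc m) = (-1) ^ Suc m * ((real m + \<nu> + 2) * R) / fact (Suc m)"
      by (simp add: c_def add_ac del: fact_Suc)
    moreover have "c (\<nu> + 1) (Suc m) = (-1) ^ Suc m * R / fact (Suc m)"
      by (simp add: c_def R_def add_ac del: fact_Suc)
    moreover have "c (\<nu> + 2) m = - ((-1) ^ Suc m * ((real m + 1) * R) / fact (Suc m))"
    proof -
      have "(real m + 1) * R / fact (Suc m) = R / fact m"
        by (simp add: add_ac del: of_nat_Suc) (simp add: add_ac)
      then have "(-1) ^ m * (R / fact m) = (-1) ^ m * ((real m + 1) * R / fact (Suc m))"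
        by (simp only:)
      then show ?thesis by (simp add: c_def R_def add_ac del: fact_Suc)
    qed
    ultimately show ?thesis
      by (simp add: algebra_simps add_divide_distrib diff_divide_distrib del: fact_Suc)
  qed
  have "Bessel_Clifford \<nu> z = c \<nu> 0 + (\<Sum>m. c \<nu> (Suc m) * z ^ Suc m)"
    using suminf_split_head[OF s[OF assms]] by (simp add: Bessel_Clifford_def c_def)
  also have "(\<Sum>m. c \<nu> (Suc m) * z ^ Suc m)
      = (\<Sum>m. (\<nu> + 1) * (c (\<nu> + 1) (Suc m) * z ^ Suc m) - z * (c (\<nu> + 2) m * z ^ m))"
    by (simp only: cS) (simp add: algebra_simps)
  also have "\<dots> = (\<nu> + 1) * (\<Sum>m. c (\<nu> + 1) (Suc m) * z ^ Suc m) - z * (\<Sum>m. c (\<nu> + 2) m * z ^ m)"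
  proof -
    have a: "summable (\<lambda>m. c (\<nu> + 1) (Suc m) * z ^ Suc m)"
      using s[of "\<nu> + 1"] assms by (subst summable_Suc_iff) simp
    have b: "summable (\<lambda>m. c (\<nu> + 2) m * z ^ m)" using s[of "\<nu> + 2"] assms by simp
    show ?thesis
      by (simp add: suminf_diff[OF summable_mult[OF a] summable_mult[OF b], symmetric]
            suminf_mult[OF a, symmetric] suminf_mult[OF b, symmetric] del: power_Suc)
  qed
  also have "(\<Sum>m. c (\<nu> + 1) (Suc m) * z ^ Suc m) = Bessel_Clifford (\<nu> + 1) z - c (\<nu> + 1) 0"
    using suminf_split_head[OF s[of "\<nu> + 1"]] assms by (simp add: Bessel_Clifford_def c_def)
  also have "(\<Sum>m. c (\<nu> + 2) m * z ^ m) = Bessel_Clifford (\<nu> + 2) z"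
    by (simp add: Bessel_Clifford_def c_def)
  finally show ?thesis using c0 by (simp add: algebra_simps)
qed

lemma Bessel_J_conv_Clifford:
  assumes "x > 0" "\<nu> \<ge> 0"
  shows "Bessel_J \<nu> x = (x / 2) powr \<nu> * Bessel_Clifford \<nu> (x\<^sup>2 / 4)"
proof -
  have "(x / 2) powr (2 * real m + \<nu>) = (x / 2) powr \<nu> * (x\<^sup>2 / 4) ^ m" for m
  proof -
    have "(x / 2) powr (2 * real m) = (x / 2) ^ (2 * m)"
      using assms by (simp flip: powr_realpow)
    then show ?thesis using assms by (simp add: powr_add power_mult power_divide)
  qed
  then have "Bessel_J \<nu> x = (\<Sum>m. (x / 2) powr \<nu> *
      ((-1) ^ m * rGamma (real m + \<nu> + 1) / fact m * (x\<^sup>2 / 4) ^ m))"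
    unfolding Bessel_J_def by (simp add: mult_ac)
  also have "\<dots> = (x / 2) powr \<nu> * Bessel_Clifford \<nu> (x\<^sup>2 / 4)"
    unfolding Bessel_Clifford_def by (rule suminf_mult[OF Bessel_Clifford_summable[OF assms(2)]])
  finally show ?thesis .
qed

section \<open>The Bessel equation in the logarithmic variable\<close>

text \<open>
  Writing \<open>x = e\<^sup>t\<close> removes the first-order term from the Bessel equation, so that Wronskians of
  solutions have a derivative of constant sign wherever the potentials are ordered.  The singular
  point \<open>x = 0\<close> moves to \<open>t = -\<infinity>\<close>.
\<close>

definition log_Bessel :: "real \<Rightarrow> real \<Rightarrow> real" where
  "log_Bessel \<nu> t = Bessel_J \<nu> (exp t)"

lemma log_Bessel_conv_Clifford:
  assumes "\<nu> \<ge> 0"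
  shows "log_Bessel \<nu> t = exp (\<nu> * (t - ln 2)) * Bessel_Clifford \<nu> (exp (2 * t) / 4)"
proof -
  have "(exp t / 2) powr \<nu> = exp (\<nu> * (t - ln 2))"
    by (simp add: powr_def ln_div)
  moreover have "(exp t)\<^sup>2 = exp (2 * t)" by (simp flip: exp_double)
  ultimately show ?thesis
    using Bessel_J_conv_Clifford[OF exp_gt_zero assms, of t] by (simp add: log_Bessel_def)
qed

lemma log_Bessel_recurrence:
  assumes "\<nu> \<ge> 0"
  shows "exp t * log_Bessel (\<nu> + 2) t = 2 * (\<nu> + 1) * log_Bessel (\<nu> + 1) t - exp t * log_Bessel \<nu> t"
proof -
  have s: "exp ((\<nu> + 1) * (t - ln 2)) = exp (\<nu> * (t - ln 2)) * (exp t / 2)"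
    "exp ((\<nu> + 2) * (t - ln 2)) = exp (\<nu> * (t - ln 2)) * (exp t / 2)\<^sup>2"
    using exp_double[of "ln 2 :: real"] exp_double[of t]
    by (simp_all add: algebra_simps exp_add exp_diff power2_eq_square power_divide)
  have "exp (2 * t) = exp t * exp t" by (simp add: exp_double power2_eq_square)
  then show ?thesis
    using assms
    by (simp add: log_Bessel_conv_Clifford s Bessel_Clifford_recurrence[OF assms] power2_eq_square)
       (simp add: field_simps)
qed

lemma DERIV_log_Bessel:
  assumes "\<nu> \<ge> 0"
  shows "(log_Bessel \<nu> has_real_derivative
           \<nu> * log_Bessel \<nu> t - exp t * log_Bessel (\<nu> + 1) t) (at t)"
proof -
  have "((\<lambda>t. exp (\<nu> * (t - ln 2)) * Bessel_Clifford \<nu> (exp (2 * t) / 4)) has_real_derivative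
      \<nu> * exp (\<nu> * (t - ln 2)) * Bessel_Clifford \<nu> (exp (2 * t) / 4)
       - exp (\<nu> * (t - ln 2)) * Bessel_Clifford (\<nu> + 1) (exp (2 * t) / 4) * (exp (2 * t) / 2)) (at t)"
    by (auto intro!: derivative_eq_intros DERIV_chain2[OF DERIV_Bessel_Clifford[OF assms]])
  moreover have "exp ((\<nu> + 1) * (t - ln 2)) = exp (\<nu> * (t - ln 2)) * (exp t / 2)"
    by (simp add: algebra_simps exp_add exp_diff)
  moreover have "exp (2 * t) = exp t * exp t" by (simp add: exp_double power2_eq_square)
  moreover have "log_Bessel \<nu> = (\<lambda>t. exp (\<nu> * (t - ln 2)) * Bessel_Clifford \<nu> (exp (2 * t) / 4))"
    using log_Bessel_conv_Clifford[OF assms] by blast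
  ultimately show ?thesis
    using assms by (simp only: log_Bessel_conv_Clifford[of "\<nu> + 1"]) (simp add: mult_ac)
qed

text \<open>
  The derivative \<open>x J\<^sub>\<nu>'(x) = \<nu> J\<^sub>\<nu>(x) - x J\<^sub>\<nu>\<^sub>+\<^sub>1(x)\<close> of \<open>log_Bessel\<close> with respect to \<open>t\<close>.
\<close>

definition log_Bessel_deriv :: "real \<Rightarrow> real \<Rightarrow> real" where
  "log_Bessel_deriv \<nu> t = \<nu> * log_Bessel \<nu> t - exp t * log_Bessel (\<nu> + 1) t"

lemma log_Bessel_ODE:
  assumes "\<nu> \<ge> 0"
  shows "(log_Bessel \<nu> has_real_derivative log_Bessel_deriv \<nu> t) (at t)"
    and "(log_Bessel_deriv \<nu> has_real_derivative (\<nu>\<^sup>2 - exp (2 * t)) * log_Bessel \<nu> t) (at t)"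
proof -
  show "(log_Bessel \<nu> has_real_derivative log_Bessel_deriv \<nu> t) (at t)"
    using DERIV_log_Bessel[OF assms] by (simp add: log_Bessel_deriv_def)
  have "(log_Bessel_deriv \<nu> has_real_derivative
      \<nu> * (\<nu> * log_Bessel \<nu> t - exp t * log_Bessel (\<nu> + 1) t) -
      (exp t * log_Bessel (\<nu> + 1) t +
       exp t * ((\<nu> + 1) * log_Bessel (\<nu> + 1) t - exp t * log_Bessel (\<nu> + 2) t))) (at t)"
    unfolding log_Bessel_deriv_def[abs_def]
    using assms by (auto intro!: derivative_eq_intros DERIV_log_Bessel simp: add_ac mult_ac)
  moreover have "exp (2 * t) = exp t * exp t" by (simp add: exp_double power2_eq_square)
  ultimately show "(log_Bessel_deriv \<nu> has_real_derivative (\<nu>\<^sup>2 - exp (2 * t)) * log_Bessel \<nu> t) (at t)"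
    by (simp only: log_Bessel_recurrence[OF assms]) (simp add: algebra_simps power2_eq_square)
qed

text \<open>
  This is \<open>(x\<^sup>\<nu>\<^sup>+\<^sup>1 J\<^sub>\<nu>\<^sub>+\<^sub>1)' = x\<^sup>\<nu>\<^sup>+\<^sup>1 J\<^sub>\<nu>\<close>, up to the factor \<open>x\<close> that differentiation with respect to
  \<open>t = ln x\<close> brings in.
\<close>

lemma DERIV_weighted_log_Bessel:
  assumes "\<nu> \<ge> 0"
  shows "((\<lambda>t. exp ((\<nu> + 1) * t) * log_Bessel (\<nu> + 1) t) has_real_derivative
           exp ((\<nu> + 1) * t) * (exp t * log_Bessel \<nu> t)) (at t)"
proof -
  have "((\<lambda>t. exp ((\<nu> + 1) * t) * log_Bessel (\<nu> + 1) t) has_real_derivative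
      (\<nu> + 1) * exp ((\<nu> + 1) * t) * log_Bessel (\<nu> + 1) t +
      exp ((\<nu> + 1) * t) * ((\<nu> + 1) * log_Bessel (\<nu> + 1) t - exp t * log_Bessel (\<nu> + 2) t)) (at t)"
    using assms DERIV_log_Bessel[of "\<nu> + 1" t]
    by (auto intro!: derivative_eq_intros simp: add_ac mult_ac)
  then show ?thesis
    by (simp only: log_Bessel_recurrence[OF assms]) (simp add: algebra_simps)
qed

lemma exp_double_div4_at_bot: "((\<lambda>t::real. exp (2 * t) / 4) \<longlongrightarrow> 0) at_bot"
proof -
  have "((\<lambda>t::real. exp t * exp t / 4) \<longlongrightarrow> 0 * 0 / 4) at_bot"
    by (intro tendsto_intros exp_at_bot) auto
  then show ?thesis by (simp add: exp_double power2_eq_square)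
qed

lemma Bessel_Clifford_at_bot:
  assumes "\<nu> \<ge> 0"
  shows "((\<lambda>t. Bessel_Clifford \<nu> (exp (2 * t) / 4)) \<longlongrightarrow> rGamma (\<nu> + 1)) at_bot"
proof -
  have "isCont (Bessel_Clifford \<nu>) 0"
    using DERIV_Bessel_Clifford[OF assms] DERIV_isCont by blast
  from isCont_tendsto_compose[OF this exp_double_div4_at_bot] show ?thesis
    by (simp add: Bessel_Clifford_0)
qed

lemma exp_mult_at_bot: "((\<lambda>t::real. exp (\<nu> * (t - c))) \<longlongrightarrow> 0) at_bot" if "\<nu> > 0"
proof -
  have "filterlim (\<lambda>t::real. \<nu> * (t - c)) at_bot at_bot"
    unfolding filterlim_at_bot eventually_at_bot_linorder
  proof (intro allI exI impI)
    fix Z t :: real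
    assume "t \<le> c + Z / \<nu>"
    then show "\<nu> * (t - c) \<le> Z" using that by (simp add: field_simps)
  qed
  then show ?thesis by (rule filterlim_compose[OF exp_at_bot])
qed

lemma log_Bessel_at_bot:
  assumes "\<nu> \<ge> 0"
  shows "(log_Bessel \<nu> \<longlongrightarrow> (if \<nu> = 0 then 1 else 0)) at_bot"
proof -
  have eq: "log_Bessel \<nu> = (\<lambda>t. exp (\<nu> * (t - ln 2)) * Bessel_Clifford \<nu> (exp (2 * t) / 4))"
    using log_Bessel_conv_Clifford[OF assms] by blast
  have "((\<lambda>t. exp (\<nu> * (t - ln 2))) \<longlongrightarrow> (if \<nu> = 0 then 1 else 0)) at_bot"
    using assms exp_mult_at_bot[of \<nu> "ln 2"] by auto
  from tendsto_mult[OF this Bessel_Clifford_at_bot[OF assms]]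
  show ?thesis
    unfolding eq by (cases "\<nu> = 0") (simp_all add: rGamma_inverse_Gamma[of 1])
qed

lemma log_Bessel_deriv_at_bot:
  assumes "\<nu> \<ge> 0"
  shows "(log_Bessel_deriv \<nu> \<longlongrightarrow> 0) at_bot"
proof -
  have "((\<lambda>t. \<nu> * log_Bessel \<nu> t - exp t * log_Bessel (\<nu> + 1) t) \<longlongrightarrow>
      \<nu> * (if \<nu> = 0 then 1 else 0) - 0 * 0) at_bot"
    using log_Bessel_at_bot[of "\<nu> + 1"] assms
    by (intro tendsto_intros log_Bessel_at_bot exp_at_bot assms) auto
  then show ?thesis by (simp add: log_Bessel_deriv_def[abs_def] split: if_splits)
qed

section \<open>Sturm comparison through the Wronskian\<close>

text \<open>
  If \<open>f'' = p f\<close> and \<open>g'' = q g\<close>, the Wronskian \<open>f' g - f g'\<close> has derivative \<open>(p - q) f g\<close>.  Thus the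
  solution with the smaller potential bends down faster, which is how its zeros come first.
\<close>

lemma wronskian_mono:
  fixes f f' g g' p q :: "real \<Rightarrow> real"
  assumes "a \<le> b"
    and f: "\<And>t. (f has_real_derivative f' t) (at t)" "\<And>t. (f' has_real_derivative p t * f t) (at t)"
    and g: "\<And>t. (g has_real_derivative g' t) (at t)" "\<And>t. (g' has_real_derivative q t * g t) (at t)"
    and pos: "\<And>t. a \<le> t \<Longrightarrow> t \<le> b \<Longrightarrow> f t \<ge> 0" "\<And>t. a \<le> t \<Longrightarrow> t \<le> b \<Longrightarrow> g t \<ge> 0"
    and le: "\<And>t. a \<le> t \<Longrightarrow> t \<le> b \<Longrightarrow> q t \<le> p t"
  shows "f' a * g a - f a * g' a \<le> f' b * g b - f b * g' b"
proof (rule DERIV_nonneg_imp_nondecreasing[OF \<open>a \<le> b\<close>])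
  fix t assume t: "a \<le> t" "t \<le> b"
  have "((\<lambda>t. f' t * g t - f t * g' t) has_real_derivative (p t - q t) * (f t * g t)) (at t)"
    by (auto intro!: derivative_eq_intros f g simp: algebra_simps)
  moreover have "(p t - q t) * (f t * g t) \<ge> 0"
    using pos[OF t] le[OF t] by simp
  ultimately show "\<exists>y. ((\<lambda>t. f' t * g t - f t * g' t) has_real_derivative y) (at t) \<and> y \<ge> 0"
    by blast
qed

text \<open>
  The same on a half-line, where the decay of the Wronskian at \<open>-\<infinity>\<close> plays the part of the initial
  condition.
\<close>

lemma wronskian_nonneg:
  fixes f f' g g' p q :: "real \<Rightarrow> real"
  assumes f: "\<And>t. (f has_real_derivative f' t) (at t)" "\<And>t. (f' has_real_derivative p t * f t) (at t)"
    and g: "\<And>t. (g has_real_derivative g' t) (at t)" "\<And>t. (g' has_real_derivative q t * g t) (at t)"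
    and pos: "\<And>t. t \<le> b \<Longrightarrow> f t \<ge> 0" "\<And>t. t \<le> b \<Longrightarrow> g t \<ge> 0"
    and le: "\<And>t. t \<le> b \<Longrightarrow> q t \<le> p t"
    and lim: "((\<lambda>t. f' t * g t - f t * g' t) \<longlongrightarrow> 0) at_bot"
  shows "f' b * g b - f b * g' b \<ge> 0"
proof (rule tendsto_upperbound[OF lim])
  show "\<forall>\<^sub>F t in at_bot. f' t * g t - f t * g' t \<le> f' b * g b - f b * g' b"
    unfolding eventually_at_bot_linorder
    by (intro exI[of _ b] allI impI wronskian_mono[OF _ f g]) (auto intro: pos le)
qed simp

section \<open>The first positive zero\<close>

lemma log_Bessel_pos_near_bot:
  assumes "\<nu> \<ge> 0"
  shows "\<exists>a. \<forall>t\<le>a. log_Bessel \<nu> t > 0"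
proof -
  have "rGamma (\<nu> + 1) > 0" using assms by (intro rGamma_pos) simp
  from order_tendstoD(1)[OF Bessel_Clifford_at_bot[OF assms] this]
  have "\<forall>\<^sub>F t in at_bot. Bessel_Clifford \<nu> (exp (2 * t) / 4) > 0" .
  then show ?thesis
    unfolding eventually_at_bot_linorder by (simp add: log_Bessel_conv_Clifford[OF assms] zero_less_mult_iff)
qed

text \<open>
  Once \<open>e\<^sup>t \<ge> \<nu> + 1\<close>, the potential \<open>\<nu>\<^sup>2 - e\<^sup>2\<^sup>t\<close> is at most \<open>-1\<close>, so that \<open>J\<^sub>\<nu>\<close> oscillates at least as
  fast as the sine: a positive solution cannot survive a half period of length \<open>\<pi>\<close>.
\<close>

lemma log_Bessel_has_zero:
  assumes "\<nu> \<ge> 0"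
  shows "\<exists>t. log_Bessel \<nu> t = 0"
proof (rule ccontr)
  assume "\<not> ?thesis"
  then have nz: "log_Bessel \<nu> t \<noteq> 0" for t by blast
  obtain a where a: "log_Bessel \<nu> t > 0" if "t \<le> a" for t
    using log_Bessel_pos_near_bot[OF assms] by blast
  have cont: "isCont (log_Bessel \<nu>) t" for t
    using log_Bessel_ODE(1)[OF assms] DERIV_isCont by blast
  have pos: "log_Bessel \<nu> t > 0" for t
  proof (rule ccontr)
    assume "\<not> log_Bessel \<nu> t > 0"
    then have "log_Bessel \<nu> t \<le> 0" "a \<le> t" using a[of t] by force+
    then show False
      using IVT2[of "log_Bessel \<nu>" t 0 a] a[of a] cont nz by force
  qed
  define s where "s = ln (\<nu> + 1)"
  have "(\<nu> + 1)\<^sup>2 \<le> exp (2 * t)" if "s \<le> t" for t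
  proof -
    have "\<nu> + 1 \<le> exp t" using that assms unfolding s_def by (subst ln_le_cancel_iff[symmetric]) auto
    then have "(\<nu> + 1)\<^sup>2 \<le> (exp t)\<^sup>2" using assms by (intro power_mono) auto
    then show ?thesis by (simp add: exp_double)
  qed
  then have big: "\<nu>\<^sup>2 - exp (2 * t) \<le> -1" if "s \<le> t" for t
    using that assms by (force simp: power2_eq_square algebra_simps)
  have "cos (s - s) * log_Bessel \<nu> s - sin (s - s) * log_Bessel_deriv \<nu> s
      \<le> cos (s + pi - s) * log_Bessel \<nu> (s + pi) - sin (s + pi - s) * log_Bessel_deriv \<nu> (s + pi)"
  proof (rule wronskian_mono[where f = "\<lambda>t. sin (t - s)" and p = "\<lambda>_. -1"
        and f' = "\<lambda>t. cos (t - s)"])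
    show "((\<lambda>t. sin (t - s)) has_real_derivative cos (t - s)) (at t)"
      "((\<lambda>t. cos (t - s)) has_real_derivative - 1 * sin (t - s)) (at t)" for t
      by (auto intro!: derivative_eq_intros)
    show "sin (t - s) \<ge> 0" if "s \<le> t" "t \<le> s + pi" for t
      using that by (intro sin_ge_zero) auto
  qed (use pos big in \<open>auto intro!: log_Bessel_ODE assms intro: less_imp_le\<close>)
  then show False using pos[of s] pos[of "s + pi"] by simp
qed

text \<open>
  The zeros stay away from \<open>0\<close> because \<open>J\<^sub>\<nu>\<close> is positive there; hence they have a least element, by
  compactness, and the least-element operator in the definition of the first zero is meaningful.
  By the intermediate value theorem the first zero also precedes every argument at which \<open>J\<^sub>\<nu>\<close> is
  negative.
\<close>

lemma Bessel_J_first_zero: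
  assumes "\<nu> \<ge> 0"
  shows Bessel_J_first_zero_pos: "Bessel_J_first_zero \<nu> > 0"
    and Bessel_J_at_first_zero: "Bessel_J \<nu> (Bessel_J_first_zero \<nu>) = 0"
    and Bessel_J_pos_before_first_zero:
      "\<And>x. 0 < x \<Longrightarrow> x < Bessel_J_first_zero \<nu> \<Longrightarrow> Bessel_J \<nu> x > 0"
    and Bessel_J_first_zero_le:
      "\<And>x. 0 < x \<Longrightarrow> Bessel_J \<nu> x \<le> 0 \<Longrightarrow> Bessel_J_first_zero \<nu> \<le> x"
proof -
  obtain a where a: "log_Bessel \<nu> t > 0" if "t \<le> a" for t
    using log_Bessel_pos_near_bot[OF assms] by blast
  obtain t1 where t1: "log_Bessel \<nu> t1 = 0" using log_Bessel_has_zero[OF assms] by blast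
  have cont: "isCont (log_Bessel \<nu>) t" for t
    using log_Bessel_ODE(1)[OF assms] DERIV_isCont by blast
  have ltx: "a < t" if "log_Bessel \<nu> t \<le> 0" for t using a[of t] that by force
  let ?Z = "{a..t1} \<inter> log_Bessel \<nu> -` {0}"
  have "compact ?Z"
    by (intro compact_Int_closed compact_Icc continuous_closed_vimage) (auto intro: cont)
  moreover have "t1 \<in> ?Z" using t1 ltx[of t1] by auto
  ultimately obtain t0 where t0: "t0 \<in> ?Z" and t0min: "\<And>t. t \<in> ?Z \<Longrightarrow> t0 \<le> t"
    using compact_attains_inf[of ?Z] by blast
  have least: "t0 \<le> t" if t: "log_Bessel \<nu> t \<le> 0" for t
  proof -
    obtain u where u: "a \<le> u" "u \<le> t" "log_Bessel \<nu> u = 0"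
      using IVT2[of "log_Bessel \<nu>" t 0 a] a[of a] ltx[OF t] t cont by force
    show ?thesis
    proof (cases "u \<le> t1")
      case True
      then show ?thesis using t0min[of u] u by auto
    next
      case False
      then show ?thesis using t0 u by auto
    qed
  qed
  have ex: "x = exp (ln x)" if "x > 0" for x :: real using that by simp
  have j: "Bessel_J_first_zero \<nu> = exp t0"
    unfolding Bessel_J_first_zero_def
  proof (rule Least_equality)
    show "0 < exp t0 \<and> Bessel_J \<nu> (exp t0) = 0" using t0 by (simp add: log_Bessel_def)
    fix x assume "0 < x \<and> Bessel_J \<nu> x = 0"
    then show "exp t0 \<le> x" using least[of "ln x"] by (simp add: log_Bessel_def ln_ge_iff)
  qed
  show "Bessel_J_first_zero \<nu> > 0" "Bessel_J \<nu> (Bessel_J_first_zero \<nu>) = 0"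
    using t0 j by (auto simp: log_Bessel_def)
  show le: "Bessel_J_first_zero \<nu> \<le> x" if "0 < x" "Bessel_J \<nu> x \<le> 0" for x
    using least[of "ln x"] that j by (simp add: log_Bessel_def ln_ge_iff)
  show "Bessel_J \<nu> x > 0" if "0 < x" "x < Bessel_J_first_zero \<nu>" for x
    using le[of x] that by force
qed

lemma log_Bessel_first_zero:
  assumes "\<nu> \<ge> 0"
  shows log_Bessel_at_first_zero: "log_Bessel \<nu> (ln (Bessel_J_first_zero \<nu>)) = 0"
    and log_Bessel_pos_before_first_zero:
      "\<And>t. t < ln (Bessel_J_first_zero \<nu>) \<Longrightarrow> log_Bessel \<nu> t > 0"
proof -
  show "log_Bessel \<nu> (ln (Bessel_J_first_zero \<nu>)) = 0"
    using Bessel_J_first_zero(1,2)[OF assms] by (simp add: log_Bessel_def)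
  fix t assume "t < ln (Bessel_J_first_zero \<nu>)"
  then have "exp t < Bessel_J_first_zero \<nu>"
    using Bessel_J_first_zero_pos[OF assms] by (metis exp_less_cancel_iff exp_ln)
  then show "log_Bessel \<nu> t > 0"
    unfolding log_Bessel_def by (intro Bessel_J_pos_before_first_zero assms) auto
qed

lemma log_Bessel_nonneg:
  assumes "\<nu> \<ge> 0" "t \<le> ln (Bessel_J_first_zero \<nu>)"
  shows "log_Bessel \<nu> t \<ge> 0"
  using log_Bessel_first_zero[OF assms(1)] assms(2) by (metis less_eq_real_def)

text \<open>
  The function \<open>x\<^sup>\<nu>\<^sup>+\<^sup>1 J\<^sub>\<nu>\<^sub>+\<^sub>1\<close> starts at \<open>0\<close> and increases as long as \<open>J\<^sub>\<nu>\<close> is positive.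
\<close>

lemma log_Bessel_Suc_pos:
  assumes "\<nu> \<ge> 0" "t \<le> ln (Bessel_J_first_zero \<nu>)"
  shows "log_Bessel (\<nu> + 1) t > 0"
proof -
  define h where "h t = exp ((\<nu> + 1) * t) * log_Bessel (\<nu> + 1) t" for t
  have h: "(h has_real_derivative exp ((\<nu> + 1) * t) * (exp t * log_Bessel \<nu> t)) (at t)" for t
    unfolding h_def[abs_def] by (rule DERIV_weighted_log_Bessel[OF assms(1)])
  have "(h \<longlongrightarrow> 0 * 0) at_bot"
    unfolding h_def[abs_def]
    using exp_mult_at_bot[of "\<nu> + 1" 0] log_Bessel_at_bot[of "\<nu> + 1"] assms(1)
    by (intro tendsto_mult) auto
  then have lim: "(h \<longlongrightarrow> 0) at_bot" by simp
  have "0 < h (t - 1)"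
  proof (rule DERIV_pos_imp_increasing_at_bot[OF _ lim])
    fix s assume "s \<le> t - 1"
    then have "log_Bessel \<nu> s > 0"
      using assms by (intro log_Bessel_pos_before_first_zero) auto
    then show "\<exists>y. (h has_real_derivative y) (at s) \<and> 0 < y" using h[of s] by (auto intro!: exI)
  qed
  also have "h (t - 1) \<le> h t"
  proof (rule DERIV_nonneg_imp_nondecreasing[of "t - 1" t h])
    fix s assume "t - 1 \<le> s" "s \<le> t"
    then have "log_Bessel \<nu> s \<ge> 0" using assms by (intro log_Bessel_nonneg) auto
    then show "\<exists>y. (h has_real_derivative y) (at s) \<and> 0 \<le> y" using h[of s] by (auto intro!: exI)
  qed simp
  finally show ?thesis by (simp add: h_def zero_less_mult_iff)
qed

text \<open>
  At a zero of \<open>J\<^sub>\<nu>\<close> the derivative is \<open>- x J\<^sub>\<nu>\<^sub>+\<^sub>1(x)\<close>.  The strict sign is what yields contradictions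
  in the comparison arguments, where the Wronskian is only known to be nonnegative.
\<close>

lemma log_Bessel_deriv_first_zero_neg:
  assumes "\<nu> \<ge> 0"
  shows "log_Bessel_deriv \<nu> (ln (Bessel_J_first_zero \<nu>)) < 0"
  using log_Bessel_Suc_pos[OF assms order_refl] log_Bessel_at_first_zero[OF assms]
  by (simp add: log_Bessel_deriv_def)

text \<open>
  While \<open>x \<le> \<nu>\<close> the potential is nonnegative, so \<open>J\<^sub>\<nu>\<close> is convex in \<open>t\<close> and cannot come down to zero.
  Formally, this is the comparison with the constant solution of \<open>g'' = 0\<close>.
\<close>

lemma order_le_Bessel_J_first_zero:
  assumes "\<nu> \<ge> 0"
  shows "\<nu> \<le> Bessel_J_first_zero \<nu>"
proof (rule ccontr)
  define \<tau> where "\<tau> = ln (Bessel_J_first_zero \<nu>)"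
  assume "\<not> ?thesis"
  then have less: "Bessel_J_first_zero \<nu> < \<nu>" by simp
  have "exp (2 * t) \<le> \<nu>\<^sup>2" if "t \<le> \<tau>" for t
  proof -
    have "exp t \<le> Bessel_J_first_zero \<nu>"
      using that Bessel_J_first_zero_pos[OF assms] by (simp add: \<tau>_def ln_ge_iff)
    then have "(exp t)\<^sup>2 \<le> \<nu>\<^sup>2" using less by (intro power_mono) auto
    then show ?thesis by (simp add: exp_double)
  qed
  then have "log_Bessel_deriv \<nu> \<tau> * 1 - log_Bessel \<nu> \<tau> * 0 \<ge> 0"
    by (intro wronskian_nonneg[where g = "\<lambda>_. 1" and q = "\<lambda>_. 0" and p = "\<lambda>t. \<nu>\<^sup>2 - exp (2 * t)"
          and f = "log_Bessel \<nu>" and f' = "log_Bessel_deriv \<nu>" and g' = "\<lambda>_. 0"])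
       (auto intro: log_Bessel_ODE log_Bessel_nonneg assms log_Bessel_deriv_at_bot simp: \<tau>_def)
  then show False using log_Bessel_deriv_first_zero_neg[OF assms] by (simp add: \<tau>_def)
qed

section \<open>Growth of the first zero with the order\<close>

text \<open>
  Bernoulli's inequality for exponents below one, as weighted arithmetic-geometric mean.
\<close>

lemma powr_le_linear:
  fixes u \<alpha> :: real
  assumes "0 < u" "0 < \<alpha>" "\<alpha> \<le> 1"
  shows "u powr \<alpha> \<le> 1 + \<alpha> * (u - 1)"
  using Youngs_inequality_0[of \<alpha> "1 - \<alpha>" u 1] assms by (simp add: algebra_simps)

text \<open>
  Let \<open>j\<close> be the first zero of \<open>J\<^sub>\<nu>\<close>.  The function \<open>J\<^sub>\<mu>(k x\<^sup>\<alpha>)\<close> with \<open>k j\<^sup>\<alpha> = \<surd>B\<close> has the potential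
  \<open>\<alpha>\<^sup>2 (\<mu>\<^sup>2 - k\<^sup>2 x\<^sup>2\<^sup>\<alpha>)\<close> in the logarithmic variable.  The equation for \<open>B\<close> makes it agree with the
  potential \<open>\<nu>\<^sup>2 - x\<^sup>2\<close> of \<open>J\<^sub>\<nu>\<close> at \<open>x = j\<close>.  As a function of \<open>X = x\<^sup>2\<close> the former is convex and the
  latter linear, and the second condition compares their slopes at \<open>X = j\<^sup>2\<close>; hence the former lies
  above the latter on all of \<open>(0, j]\<close>.  By Sturm comparison \<open>J\<^sub>\<mu>(k x\<^sup>\<alpha>)\<close> has no zero before \<open>j\<close>.
\<close>

lemma Bessel_J_first_zero_comparison:
  assumes "\<nu> \<ge> 0" "\<mu> > 0" "0 < \<alpha>" "\<alpha> \<le> 1"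
    and B: "\<alpha>\<^sup>2 * (B - \<mu>\<^sup>2) = (Bessel_J_first_zero \<nu>)\<^sup>2 - \<nu>\<^sup>2"
    and slope: "\<alpha> ^ 3 * B \<ge> (Bessel_J_first_zero \<nu>)\<^sup>2"
  shows "(Bessel_J_first_zero \<mu>)\<^sup>2 \<ge> B"
proof (rule ccontr)
  define j where "j = Bessel_J_first_zero \<nu>"
  define j' where "j' = Bessel_J_first_zero \<mu>"
  assume "\<not> ?thesis"
  then have less: "j'\<^sup>2 < B" by (simp add: j'_def)
  have j: "j > 0" "j' > 0"
    using assms by (auto simp: j_def j'_def intro: Bessel_J_first_zero_pos)
  have B0: "B > 0" using less by (smt (verit) zero_le_power2)
  define \<kappa> where "\<kappa> = ln B / 2 - \<alpha> * ln j"
  \<comment> \<open>The point at which \<open>J\<^sub>\<mu>(k x\<^sup>\<alpha>)\<close>, with \<open>k = e\<^sup>\<kappa>\<close>, has its first zero.\<close>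
  define b where "b = (ln j' - \<kappa>) / \<alpha>"
  have b: "\<alpha> * b + \<kappa> = ln j'" using assms by (simp add: b_def)
  have "ln (j'\<^sup>2) < ln B" using less j B0 by simp
  then have "2 * ln j' < ln B" using j by (simp add: ln_realpow)
  then have bj: "b < ln j" using assms by (simp add: b_def \<kappa>_def field_simps)
  have le: "\<alpha>\<^sup>2 * (\<mu>\<^sup>2 - exp (2 * (\<alpha> * t + \<kappa>))) \<ge> \<nu>\<^sup>2 - exp (2 * t)" if "t \<le> b" for t
  proof -
    define u where "u = exp (2 * t) / j\<^sup>2"
    have u0: "u > 0" using j by (simp add: u_def)
    have "2 * t \<le> 2 * ln j" using that bj by simp
    then have "exp (2 * t) \<le> j\<^sup>2" using j by (metis exp_le_cancel_iff exp_double exp_ln)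
    then have u1: "u \<le> 1" using j by (simp add: u_def)
    have "ln u = 2 * (t - ln j)"
      using j by (simp add: u_def ln_div ln_realpow)
    then have "u powr \<alpha> = exp (\<alpha> * (2 * (t - ln j)))" using u0 by (simp add: powr_def)
    then have "exp (2 * (\<alpha> * t + \<kappa>)) = B * u powr \<alpha>"
      using B0 by (simp add: \<kappa>_def algebra_simps exp_add exp_diff)
    also have "\<dots> \<le> B * (1 + \<alpha> * (u - 1))"
      using B0 u0 assms by (intro mult_left_mono powr_le_linear) auto
    finally have "\<alpha>\<^sup>2 * exp (2 * (\<alpha> * t + \<kappa>)) \<le> \<alpha>\<^sup>2 * (B * (1 + \<alpha> * (u - 1)))"
      by (intro mult_left_mono) auto
    also have "\<dots> = \<alpha>\<^sup>2 * B - \<alpha> ^ 3 * B * (1 - u)"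
      by (simp add: algebra_simps power2_eq_square power3_eq_cube)
    also have "\<dots> \<le> \<alpha>\<^sup>2 * B - j\<^sup>2 * (1 - u)"
      using slope u1 by (intro diff_left_mono mult_right_mono) (auto simp: j_def)
    also have "\<dots> = \<alpha>\<^sup>2 * \<mu>\<^sup>2 - \<nu>\<^sup>2 + exp (2 * t)"
      using B j by (simp add: u_def j_def[symmetric] algebra_simps)
    finally show ?thesis by (simp add: algebra_simps)
  qed
  have lin: "filterlim (\<lambda>t. \<alpha> * t + \<kappa>) at_bot at_bot"
    unfolding filterlim_at_bot eventually_at_bot_linorder
  proof (intro allI exI impI)
    fix Z t :: real
    assume "t \<le> (Z - \<kappa>) / \<alpha>"
    then show "\<alpha> * t + \<kappa> \<le> Z" using assms by (simp add: field_simps)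
  qed
  have "(\<alpha> * log_Bessel_deriv \<mu> (\<alpha> * b + \<kappa>)) * log_Bessel \<nu> b
      - log_Bessel \<mu> (\<alpha> * b + \<kappa>) * log_Bessel_deriv \<nu> b \<ge> 0"
  proof (rule wronskian_nonneg[where f = "\<lambda>t. log_Bessel \<mu> (\<alpha> * t + \<kappa>)"
        and p = "\<lambda>t. \<alpha>\<^sup>2 * (\<mu>\<^sup>2 - exp (2 * (\<alpha> * t + \<kappa>)))" and q = "\<lambda>t. \<nu>\<^sup>2 - exp (2 * t)"])
    have \<mu>: "\<mu> \<ge> 0" using assms by simp
    fix t
    have lin': "((\<lambda>t. \<alpha> * t + \<kappa>) has_real_derivative \<alpha>) (at t)"
      by (auto intro!: derivative_eq_intros)
    show "((\<lambda>t. log_Bessel \<mu> (\<alpha> * t + \<kappa>)) has_real_derivative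
        \<alpha> * log_Bessel_deriv \<mu> (\<alpha> * t + \<kappa>)) (at t)"
      using DERIV_chain2[OF log_Bessel_ODE(1)[OF \<mu>] lin'] by (simp add: mult_ac)
    show "((\<lambda>t. \<alpha> * log_Bessel_deriv \<mu> (\<alpha> * t + \<kappa>)) has_real_derivative
        \<alpha>\<^sup>2 * (\<mu>\<^sup>2 - exp (2 * (\<alpha> * t + \<kappa>))) * log_Bessel \<mu> (\<alpha> * t + \<kappa>)) (at t)"
      using DERIV_cmult[OF DERIV_chain2[OF log_Bessel_ODE(2)[OF \<mu>] lin'], of \<alpha>]
      by (simp add: power2_eq_square mult_ac)
    show "log_Bessel \<mu> (\<alpha> * t + \<kappa>) \<ge> 0" if "t \<le> b"
    proof (rule log_Bessel_nonneg)
      have "\<alpha> * t \<le> \<alpha> * b" using that assms by simp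
      then show "\<alpha> * t + \<kappa> \<le> ln (Bessel_J_first_zero \<mu>)" using b by (simp add: j'_def)
    qed (use assms in simp)
    show "log_Bessel \<nu> t \<ge> 0" if "t \<le> b"
      using that bj assms by (intro log_Bessel_nonneg) (auto simp: j_def)
  next
    have "((\<lambda>t. \<alpha> * log_Bessel_deriv \<mu> (\<alpha> * t + \<kappa>) * log_Bessel \<nu> t
        - log_Bessel \<mu> (\<alpha> * t + \<kappa>) * log_Bessel_deriv \<nu> t) \<longlongrightarrow>
        \<alpha> * 0 * (if \<nu> = 0 then 1 else 0) - 0 * 0) at_bot"
      using log_Bessel_at_bot[of \<mu>] assms
      by (intro tendsto_intros filterlim_compose[OF _ lin] log_Bessel_at_bot log_Bessel_deriv_at_bot) auto
    then show "((\<lambda>t. \<alpha> * log_Bessel_deriv \<mu> (\<alpha> * t + \<kappa>) * log_Bessel \<nu> t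
        - log_Bessel \<mu> (\<alpha> * t + \<kappa>) * log_Bessel_deriv \<nu> t) \<longlongrightarrow> 0) at_bot" by simp
  qed (use assms le in \<open>auto intro: log_Bessel_ODE\<close>)
  moreover have "log_Bessel \<mu> (\<alpha> * b + \<kappa>) = 0"
    using log_Bessel_at_first_zero[of \<mu>] assms by (simp add: b j'_def)
  moreover have "log_Bessel_deriv \<mu> (\<alpha> * b + \<kappa>) < 0"
    using log_Bessel_deriv_first_zero_neg[of \<mu>] assms by (simp add: b j'_def)
  moreover have "log_Bessel \<nu> b > 0"
    using bj assms by (intro log_Bessel_pos_before_first_zero) (auto simp: j_def)
  ultimately show False
    using assms by (simp add: zero_le_mult_iff)
qed

text \<open>
  For given \<open>\<alpha>\<close> let \<open>B\<close> be defined by the first condition of the comparison.  The slope condition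
  becomes \<open>\<alpha>\<^sup>3 \<mu>\<^sup>2 + \<alpha> (Y - \<nu>\<^sup>2) \<ge> Y\<close>, and \<open>B\<close> improves as \<open>\<alpha>\<close> decreases.  With \<open>\<alpha> = 1 - \<epsilon>\<close> and
  \<open>(1 - \<epsilon>)\<^sup>3 \<ge> 1 - 3\<epsilon>\<close> the condition is implied by \<open>\<epsilon> N \<le> a\<close> with
  \<open>N = Y + 3\<mu>\<^sup>2 - \<nu>\<^sup>2\<close>, and the largest such \<open>\<epsilon>\<close> is taken.
\<close>

lemma Bessel_J_first_zero_square_increment:
  assumes "\<nu> \<ge> 0" "\<mu> > \<nu>"
  defines "Y \<equiv> (Bessel_J_first_zero \<nu>)\<^sup>2" and "a \<equiv> \<mu>\<^sup>2 - \<nu>\<^sup>2"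
  shows "(Bessel_J_first_zero \<mu>)\<^sup>2 \<ge> Y + 3 * a * (Y + a) / (Y + 3 * \<mu>\<^sup>2 - \<nu>\<^sup>2)"
proof -
  have Y: "Y \<ge> \<nu>\<^sup>2" "Y > 0"
    using order_le_Bessel_J_first_zero[OF assms(1)] Bessel_J_first_zero_pos[OF assms(1)] assms(1)
    unfolding Y_def by (auto intro: power_mono)
  have a: "a > 0" using assms by (simp add: a_def power_strict_mono)
  define N where "N = Y + 3 * \<mu>\<^sup>2 - \<nu>\<^sup>2"
  have N: "N > a" "N > 0" "N = Y + 3 * a + 2 * \<nu>\<^sup>2"
    using Y a by (auto simp: N_def a_def) (smt (verit) zero_le_power2)+
  define \<epsilon> where "\<epsilon> = a / N"
  have e: "0 < \<epsilon>" "\<epsilon> < 1" "\<epsilon> * N = a" using a N by (auto simp: \<epsilon>_def)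
  define \<alpha> where "\<alpha> = 1 - \<epsilon>"
  have \<alpha>: "0 < \<alpha>" "\<alpha> < 1" using e by (auto simp: \<alpha>_def)
  define B where "B = \<mu>\<^sup>2 + (Y - \<nu>\<^sup>2) / \<alpha>\<^sup>2"
  have "(Bessel_J_first_zero \<mu>)\<^sup>2 \<ge> B"
  proof (rule Bessel_J_first_zero_comparison[of \<nu> \<mu> \<alpha>])
    show "\<alpha>\<^sup>2 * (B - \<mu>\<^sup>2) = (Bessel_J_first_zero \<nu>)\<^sup>2 - \<nu>\<^sup>2"
      using \<alpha> by (simp add: B_def Y_def)
    have "\<alpha> ^ 3 * B = \<alpha> ^ 3 * \<mu>\<^sup>2 + \<alpha> * (Y - \<nu>\<^sup>2)"
      using \<alpha> by (simp add: B_def distrib_left power2_eq_square power3_eq_cube)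
    also have "\<dots> \<ge> (1 - 3 * \<epsilon>) * \<mu>\<^sup>2 + \<alpha> * (Y - \<nu>\<^sup>2)"
    proof -
      have "\<alpha> ^ 3 = 1 - 3 * \<epsilon> + \<epsilon>\<^sup>2 * (3 - \<epsilon>)"
        by (simp add: \<alpha>_def power2_eq_square power3_eq_cube algebra_simps)
      moreover have "\<epsilon>\<^sup>2 * (3 - \<epsilon>) \<ge> 0" using e by simp
      ultimately show ?thesis by (intro add_right_mono mult_right_mono) auto
    qed
    also have "(1 - 3 * \<epsilon>) * \<mu>\<^sup>2 + \<alpha> * (Y - \<nu>\<^sup>2) = Y + a - \<epsilon> * N"
      by (simp add: \<alpha>_def a_def N_def algebra_simps)
    finally show "(Bessel_J_first_zero \<nu>)\<^sup>2 \<le> \<alpha> ^ 3 * B" using e by (simp add: Y_def)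
  qed (use assms \<alpha> in auto)
  moreover have "B \<ge> Y + 3 * a * (Y + a) / N"
  proof -
    have "(1 + 2 * \<epsilon>) * \<alpha>\<^sup>2 = 1 - \<epsilon>\<^sup>2 * (3 - 2 * \<epsilon>)"
      by (simp add: \<alpha>_def power2_eq_square algebra_simps)
    also have "\<dots> \<le> 1" using e by simp
    finally have "1 + 2 * \<epsilon> \<le> 1 / \<alpha>\<^sup>2" using \<alpha> by (simp add: field_simps)
    then have "(Y - \<nu>\<^sup>2) * (1 + 2 * \<epsilon>) \<le> (Y - \<nu>\<^sup>2) * (1 / \<alpha>\<^sup>2)"
      using Y by (intro mult_left_mono) auto
    then have "B \<ge> \<mu>\<^sup>2 + (Y - \<nu>\<^sup>2) * (1 + 2 * \<epsilon>)" by (simp add: B_def)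
    moreover have "\<mu>\<^sup>2 + (Y - \<nu>\<^sup>2) * (1 + 2 * \<epsilon>) = Y + a * (N + 2 * (Y - \<nu>\<^sup>2)) / N"
      using N(2) by (simp add: \<epsilon>_def a_def field_simps)
    moreover have "a * (N + 2 * (Y - \<nu>\<^sup>2)) = 3 * a * (Y + a)"
      by (simp add: N_def a_def algebra_simps)
    ultimately show ?thesis by (simp only:)
  qed
  ultimately show ?thesis by (simp add: N_def)
qed

section \<open>Bounds for the first zero from truncated series\<close>

text \<open>
  The moduli of consecutive terms have the quotient \<open>z / ((m + 1) (m + \<nu> + 1))\<close>.  The assumption
  \<open>z \<le> 2 (\<nu> + 2)\<close> makes them decrease from \<open>m = 1\<close> on, though not from \<open>m = 0\<close>; so the alternating
  series test applies to the series without its first term.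
\<close>

lemma Bessel_Clifford_truncation:
  assumes "\<nu> \<ge> 0" "0 \<le> z" "z \<le> 2 * (\<nu> + 2)"
  defines "S \<equiv> 1 - z / (\<nu> + 1) + z\<^sup>2 / (2 * (\<nu> + 1) * (\<nu> + 2))
              - z ^ 3 / (6 * (\<nu> + 1) * (\<nu> + 2) * (\<nu> + 3))"
  shows "rGamma (\<nu> + 1) * S \<le> Bessel_Clifford \<nu> z"
    and "Bessel_Clifford \<nu> z \<le> rGamma (\<nu> + 1) *
           (S + z ^ 4 / (24 * (\<nu> + 1) * (\<nu> + 2) * (\<nu> + 3) * (\<nu> + 4)))"
proof -
  define a where "a m = rGamma (real m + \<nu> + 1) / fact m * z ^ m" for m
  have a_nonneg: "a m \<ge> 0" for m
    using assms rGamma_pos[of "real m + \<nu> + 1"] by (simp add: a_def)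
  have a_Suc: "a (Suc m) = a m * (z / ((real m + 1) * (real m + \<nu> + 1)))" for m
  proof -
    have "rGamma (real (Suc m) + \<nu> + 1) = rGamma (real m + \<nu> + 1) / (real m + \<nu> + 1)"
      using rGamma_plus1[of "real m + \<nu> + 1"] assms by (simp add: field_simps)
    then show ?thesis by (simp add: a_def add_ac mult_ac)
  qed
  have summ: "summable (\<lambda>m. (-1) ^ m * a m)"
    using Bessel_Clifford_summable[OF assms(1), of z] by (simp add: a_def mult_ac)
  have sum_eq: "Bessel_Clifford \<nu> z = (\<Sum>m. (-1) ^ m * a m)"
    by (simp add: Bessel_Clifford_def a_def mult_ac)
  have dec: "a (Suc m) \<le> a m" if "m \<ge> 1" for m
  proof -
    have "z \<le> 2 * (\<nu> + 2)" by fact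
    also have "\<dots> \<le> (real m + 1) * (real m + \<nu> + 1)"
      using that assms by (intro mult_mono) auto
    finally have "z / ((real m + 1) * (real m + \<nu> + 1)) \<le> 1"
      using assms by (simp add: divide_le_eq_1)
    then have "a m * (z / ((real m + 1) * (real m + \<nu> + 1))) \<le> a m * 1"
      using a_nonneg by (intro mult_left_mono)
    then show ?thesis by (simp add: a_Suc)
  qed
  have "(\<lambda>m. (-1) ^ m * a m) \<longlonglongrightarrow> 0" by (rule summable_LIMSEQ_zero[OF summ])
  then have "(\<lambda>m. norm ((-1) ^ m * a m)) \<longlonglongrightarrow> 0" by (rule tendsto_norm_zero)
  then have "a \<longlonglongrightarrow> 0" using a_nonneg by (simp add: abs_mult power_abs)
  then have lim: "(\<lambda>m. a (Suc m)) \<longlonglongrightarrow> 0" by (rule LIMSEQ_Suc)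
  have split: "(\<Sum>m. (-1) ^ m * a m) = a 0 - (\<Sum>m. (-1) ^ m * a (Suc m))"
  proof -
    have "summable (\<lambda>m. (-1) ^ m * a (Suc m))"
      using lim a_nonneg dec by (intro summable_Leibniz') auto
    then show ?thesis using suminf_split_head[OF summ] by (simp add: suminf_minus)
  qed
  have low: "(\<Sum>m<4. (-1) ^ m * a (Suc m)) \<le> (\<Sum>m. (-1) ^ m * a (Suc m))"
    using summable_Leibniz'(2)[OF lim, of 2] a_nonneg dec by simp
  have up: "(\<Sum>m. (-1) ^ m * a (Suc m)) \<le> (\<Sum>m<3. (-1) ^ m * a (Suc m))"
    using summable_Leibniz'(4)[OF lim, of 1] a_nonneg dec by simp
  have vals: "a 0 = rGamma (\<nu> + 1)" "a 1 = rGamma (\<nu> + 1) * (z / (\<nu> + 1))"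
    "a 2 = rGamma (\<nu> + 1) * (z\<^sup>2 / (2 * (\<nu> + 1) * (\<nu> + 2)))"
    "a 3 = rGamma (\<nu> + 1) * (z ^ 3 / (6 * (\<nu> + 1) * (\<nu> + 2) * (\<nu> + 3)))"
    "a 4 = rGamma (\<nu> + 1) * (z ^ 4 / (24 * (\<nu> + 1) * (\<nu> + 2) * (\<nu> + 3) * (\<nu> + 4)))"
  proof -
    show a0: "a 0 = rGamma (\<nu> + 1)" by (simp add: a_def)
    show a1: "a 1 = rGamma (\<nu> + 1) * (z / (\<nu> + 1))" using a_Suc[of 0] a0 by simp
    show a2: "a 2 = rGamma (\<nu> + 1) * (z\<^sup>2 / (2 * (\<nu> + 1) * (\<nu> + 2)))"
      using a_Suc[of 1] a1 assms by (simp add: eval_nat_numeral) (simp add: field_simps)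
    show a3: "a 3 = rGamma (\<nu> + 1) * (z ^ 3 / (6 * (\<nu> + 1) * (\<nu> + 2) * (\<nu> + 3)))"
      using a_Suc[of 2] a2 assms by (simp add: eval_nat_numeral) (simp add: field_simps)
    show a4: "a 4 = rGamma (\<nu> + 1) * (z ^ 4 / (24 * (\<nu> + 1) * (\<nu> + 2) * (\<nu> + 3) * (\<nu> + 4)))"
      using a_Suc[of 3] a3 assms by (simp add: eval_nat_numeral) (simp add: field_simps)
  qed
  have s3: "(\<Sum>m<3. (-1) ^ m * a (Suc m)) = a 1 - a 2 + a 3"
    and s4: "(\<Sum>m<4. (-1) ^ m * a (Suc m)) = a 1 - a 2 + a 3 - a 4"
    by (simp_all add: eval_nat_numeral)
  show "rGamma (\<nu> + 1) * S \<le> Bessel_Clifford \<nu> z"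
    using up unfolding sum_eq split s3 vals S_def by (simp add: algebra_simps)
  show "Bessel_Clifford \<nu> z \<le> rGamma (\<nu> + 1) *
           (S + z ^ 4 / (24 * (\<nu> + 1) * (\<nu> + 2) * (\<nu> + 3) * (\<nu> + 4)))"
    using low unfolding sum_eq split s4 vals S_def by (simp add: algebra_simps)
qed

text \<open>
  The cubic truncation of the series is positive for \<open>z \<le> 3/2 (\<nu> + 1)\<close>.  The factor \<open>3/2\<close> is close to
  the limit of what the cubic gives at \<open>\<nu> = 1/2\<close>.
\<close>

lemma Bessel_J_first_zero_square_lower:
  assumes "\<nu> \<ge> 1 / 2"
  shows "6 * (\<nu> + 1) \<le> (Bessel_J_first_zero \<nu>)\<^sup>2"
proof (rule ccontr)
  define j where "j = Bessel_J_first_zero \<nu>"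
  have j: "j > 0" using assms by (auto simp: j_def intro: Bessel_J_first_zero_pos)
  assume "\<not> ?thesis"
  then have less: "j\<^sup>2 / 4 < 3 / 2 * (\<nu> + 1)" by (simp add: j_def)
  \<comment> \<open>In the scaled variable \<open>k\<close> the assumption becomes \<open>k < 3/2\<close> for every order.\<close>
  define k where "k = j\<^sup>2 / 4 / (\<nu> + 1)"
  have z: "j\<^sup>2 / 4 = k * (\<nu> + 1)" proof -
    have "q = q / (\<nu> + 1) * (\<nu> + 1)" for q using assms by simp
    from this[of "j\<^sup>2 / 4"] show ?thesis unfolding k_def .
  qed
  have k: "0 < k" "k < 3 / 2" using less j assms by (auto simp: k_def field_simps)
  have "0 < 6 * (\<nu> + 2) * (\<nu> + 3) * (1 - k) + 3 * k\<^sup>2 * (\<nu> + 1) * (\<nu> + 3) - k ^ 3 * (\<nu> + 1)\<^sup>2"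
  proof -
    define e where "e = 3 / 2 - k"
    have k_eq: "k = 3 / 2 - e" by (simp add: e_def)
    \<comment> \<open>Expansion in powers of \<open>e\<close>, with the square completed in the factor of \<open>e\<close>.\<close>
    have "6 * (\<nu> + 2) * (\<nu> + 3) * (1 - k) + 3 * k\<^sup>2 * (\<nu> + 1) * (\<nu> + 3) - k ^ 3 * (\<nu> + 1)\<^sup>2
        = (3 / 8 * \<nu>\<^sup>2 + 21 / 4 * \<nu> - 9 / 8)
          + e * (((\<nu> + 1) * e + 9 / 4 - 3 / 4 * \<nu>)\<^sup>2 + 51 / 16 * \<nu>\<^sup>2 + 87 / 8 * \<nu> + 171 / 16)"
      unfolding k_eq by (simp add: power2_eq_square power3_eq_cube field_simps)
    moreover have "e * (((\<nu> + 1) * e + 9 / 4 - 3 / 4 * \<nu>)\<^sup>2 + 51 / 16 * \<nu>\<^sup>2 + 87 / 8 * \<nu> + 171 / 16) \<ge> 0"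
      using assms k by (intro mult_nonneg_nonneg add_nonneg_nonneg) (auto simp: e_def)
    moreover have "3 / 8 * \<nu>\<^sup>2 + 21 / 4 * \<nu> - 9 / 8 > 0"
      using assms zero_le_power2[of \<nu>] by linarith
    ultimately show ?thesis by linarith
  qed
  then have "0 < (6 * (\<nu> + 2) * (\<nu> + 3) * (1 - k) + 3 * k\<^sup>2 * (\<nu> + 1) * (\<nu> + 3) - k ^ 3 * (\<nu> + 1)\<^sup>2)
      / (6 * (\<nu> + 2) * (\<nu> + 3))"
    using assms by simp
  also have "\<dots> = 1 - k + k\<^sup>2 * (\<nu> + 1) / (2 * (\<nu> + 2)) - k ^ 3 * (\<nu> + 1)\<^sup>2 / (6 * (\<nu> + 2) * (\<nu> + 3))"
  proof -
    have "\<nu> + 2 \<noteq> 0" "\<nu> + 3 \<noteq> 0" using assms by auto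
    then show ?thesis by (simp add: divide_simps) (simp add: algebra_simps)
  qed
  also have "\<dots> = 1 - (j\<^sup>2 / 4) / (\<nu> + 1) + (j\<^sup>2 / 4)\<^sup>2 / (2 * (\<nu> + 1) * (\<nu> + 2))
              - (j\<^sup>2 / 4) ^ 3 / (6 * (\<nu> + 1) * (\<nu> + 2) * (\<nu> + 3))" (is "_ = ?S")
  proof -
    have "\<nu> + 1 \<noteq> 0" "\<nu> + 2 \<noteq> 0" "\<nu> + 3 \<noteq> 0" using assms by auto
    then show ?thesis
      unfolding z by (simp add: divide_simps) (simp add: power2_eq_square power3_eq_cube algebra_simps)
  qed
  finally have "0 < rGamma (\<nu> + 1) * ?S" using assms rGamma_pos[of "\<nu> + 1"] by simp
  also have "\<dots> \<le> Bessel_Clifford \<nu> (j\<^sup>2 / 4)"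
    using assms less by (intro Bessel_Clifford_truncation) auto
  finally have "Bessel_J \<nu> j > 0" using j assms by (simp add: Bessel_J_conv_Clifford)
  then show False using Bessel_J_at_first_zero[of \<nu>] assms by (simp add: j_def)
qed

lemma Bessel_J_first_zero_square_upper:
  assumes "\<nu> \<ge> 0" "z > 0" "z \<le> 2 * (\<nu> + 2)"
    and "1 - z / (\<nu> + 1) + z\<^sup>2 / (2 * (\<nu> + 1) * (\<nu> + 2))
              - z ^ 3 / (6 * (\<nu> + 1) * (\<nu> + 2) * (\<nu> + 3))
              + z ^ 4 / (24 * (\<nu> + 1) * (\<nu> + 2) * (\<nu> + 3) * (\<nu> + 4)) \<le> 0"
  shows "(Bessel_J_first_zero \<nu>)\<^sup>2 \<le> 4 * z"
proof -
  define x where "x = 2 * sqrt z"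
  have x: "x > 0" "x\<^sup>2 / 4 = z" using assms by (auto simp: x_def power_mult_distrib)
  have "rGamma (\<nu> + 1) > 0" using assms by (intro rGamma_pos) auto
  then have "Bessel_Clifford \<nu> z \<le> 0"
    using Bessel_Clifford_truncation(2)[of \<nu> z] assms
    by (smt (verit) mult_nonneg_nonpos)
  then have "Bessel_J \<nu> x \<le> 0"
    using x assms by (simp add: Bessel_J_conv_Clifford mult_nonneg_nonpos)
  then have "Bessel_J_first_zero \<nu> \<le> x" using x assms by (intro Bessel_J_first_zero_le) auto
  then have "(Bessel_J_first_zero \<nu>)\<^sup>2 \<le> x\<^sup>2"
    using Bessel_J_first_zero_pos[OF assms(1)] by (intro power_mono) auto
  then show ?thesis using x by simp
qed

section \<open>A quotient of Gamma values\<close>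

lemma Gamma_real_nonzero: "Gamma x \<noteq> 0" if "x > 0" for x :: real
  using Gamma_real_pos[OF that] by (metis less_irrefl)

text \<open>
  Log-convexity of \<open>\<Gamma>\<close> at the midpoint of \<open>x\<close> and \<open>x + 1\<close>.
\<close>

lemma Gamma_plus_half_le:
  fixes x :: real
  assumes "x > 0"
  shows "Gamma (x + 1 / 2) ^ 2 \<le> x * Gamma x ^ 2"
proof -
  have "ln (Gamma ((1 - 1 / 2) *\<^sub>R x + (1 / 2) *\<^sub>R (x + 1)))
      \<le> (1 - 1 / 2) * ln (Gamma x) + 1 / 2 * ln (Gamma (x + 1))"
    using convex_onD[OF log_convex_Gamma_real, of "1 / 2" x "x + 1"] assms by simp
  also have "(1 - 1 / 2) *\<^sub>R x + (1 / 2) *\<^sub>R (x + 1) = x + 1 / 2" by (simp add: field_simps)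
  finally have "ln (Gamma (x + 1 / 2) ^ 2) \<le> ln (Gamma x * Gamma (x + 1))"
    using assms by (simp add: ln_realpow ln_mult Gamma_real_nonzero)
  then have "Gamma (x + 1 / 2) ^ 2 \<le> Gamma x * Gamma (x + 1)"
    using assms by (subst (asm) ln_le_cancel_iff) (auto simp: Gamma_real_nonzero)
  also have "Gamma (x + 1) = x * Gamma x"
    using assms by (intro Gamma_plus1) (auto dest: nonpos_Ints_nonpos)
  finally show ?thesis by (simp add: power2_eq_square mult_ac)
qed

text \<open>
  The quotient of the two sides increases under \<open>x \<mapsto> x + 1\<close>, by the functional equation and a
  polynomial inequality in which all but the two lowest powers of \<open>x\<close> cancel.  By
  log-convexity it is bounded along \<open>x + n\<close> by a sequence that tends to \<open>1\<close>, so it is at most \<open>1\<close> from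
  the start.
\<close>

lemma Gamma_quotient_power4_le:
  fixes x :: real
  assumes "x > 0"
  shows "(Gamma (x + 1 / 2) / Gamma x) ^ 4 \<le> x\<^sup>2 - x / 2 + 1 / 8"
proof -
  define P where "P y = y\<^sup>2 - y / 2 + 1 / 8" for y :: real
  define r where "r y = (Gamma (y + 1 / 2) / Gamma y) ^ 4" for y :: real
  have P: "P y > 0" for y
  proof -
    have "P y = (y - 1 / 4)\<^sup>2 + 1 / 16" by (simp add: P_def power2_eq_square algebra_simps)
    then show ?thesis by (simp add: add_nonneg_pos)
  qed
  have r: "r y > 0" if "y > 0" for y
    using that by (simp add: r_def Gamma_real_nonzero)
  have step: "r y / P y \<le> r (y + 1) / P (y + 1)" if y: "y > 0" for y
  proof -
    have "y \<notin> \<int>\<^sub>\<le>\<^sub>0" "y + 1 / 2 \<notin> \<int>\<^sub>\<le>\<^sub>0"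
      using y by (auto dest: nonpos_Ints_nonpos)
    note this[THEN Gamma_plus1]
    then have "r (y + 1) = ((y + 1 / 2) / y) ^ 4 * r y"
      by (simp add: r_def add_ac power_divide power_mult_distrib)
    then have y4: "y ^ 4 * r (y + 1) = (y + 1 / 2) ^ 4 * r y"
      using y by (simp add: power_divide)
    have "r y * (y ^ 4 * P (y + 1)) \<le> r y * ((y + 1 / 2) ^ 4 * P y)"
    proof (rule mult_left_mono)
      have "(y + 1 / 2) ^ 4 * P y - y ^ 4 * P (y + 1) = y / 32 + 1 / 128"
        by (simp add: P_def eval_nat_numeral field_simps)
      then show "y ^ 4 * P (y + 1) \<le> (y + 1 / 2) ^ 4 * P y" using y by simp
    qed (use r[OF y] in simp)
    also have "\<dots> = (y ^ 4 * r (y + 1)) * P y" unfolding y4 by (simp only: mult_ac)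
    finally have "y ^ 4 * (r y * P (y + 1)) \<le> y ^ 4 * (r (y + 1) * P y)"
      by (simp only: mult_ac)
    then have "r y * P (y + 1) \<le> r (y + 1) * P y"
      using y by (simp only: mult_le_cancel_left_pos zero_less_power)
    then show ?thesis
      using P[of y] P[of "y + 1"] by (simp add: field_simps)
  qed
  have mono: "r x / P x \<le> r (x + real n) / P (x + real n)" for n
  proof (induction n)
    case (Suc n)
    also have "r (x + real n) / P (x + real n) \<le> r (x + real n + 1) / P (x + real n + 1)"
      using assms by (intro step) auto
    finally show ?case by (simp add: add_ac)
  qed simp
  have bound: "r x / P x \<le> (x + real n)\<^sup>2 / P (x + real n)" for n
  proof -
    have "(Gamma (x + real n + 1 / 2) / Gamma (x + real n))\<^sup>2 \<le> x + real n"
      using Gamma_plus_half_le[of "x + real n"] Gamma_real_pos[of "x + real n"] assms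
      by (simp add: power_divide divide_le_eq)
    then have "((Gamma (x + real n + 1 / 2) / Gamma (x + real n))\<^sup>2)\<^sup>2 \<le> (x + real n)\<^sup>2"
      by (intro power_mono) auto
    then have "r (x + real n) \<le> (x + real n)\<^sup>2" by (simp add: r_def)
    then show ?thesis
      using mono[of n] P[of "x + real n"] by (smt (verit) divide_right_mono)
  qed
  have "(\<lambda>n. (x + real n)\<^sup>2 / P (x + real n)) \<longlonglongrightarrow> 1"
  proof -
    have top: "filterlim (\<lambda>n. x + real n) at_top sequentially"
      by (intro filterlim_tendsto_add_at_top[OF tendsto_const] filterlim_real_sequentially)
    have inv: "(\<lambda>n. inverse (x + real n)) \<longlonglongrightarrow> 0"
      using filterlim_compose[OF tendsto_inverse_0_at_top[OF filterlim_ident] top] by simp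
    have "(\<lambda>n. 1 / (1 - inverse (x + real n) / 2 + (inverse (x + real n))\<^sup>2 / 8))
        \<longlonglongrightarrow> 1 / (1 - 0 / 2 + 0\<^sup>2 / 8)"
      by (intro tendsto_intros inv) auto
    moreover have "y\<^sup>2 / P y = 1 / (1 - inverse y / 2 + (inverse y)\<^sup>2 / 8)" if "y > 0" for y
    proof -
      have "P y = y\<^sup>2 * (1 - inverse y / 2 + (inverse y)\<^sup>2 / 8)"
        using that by (simp add: P_def field_simps power2_eq_square)
      then show ?thesis using that by simp
    qed
    then have "(x + real n)\<^sup>2 / P (x + real n)
        = 1 / (1 - inverse (x + real n) / 2 + (inverse (x + real n))\<^sup>2 / 8)" for n
      using assms by (simp add: add_pos_nonneg)
    ultimately show ?thesis by simp
  qed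
  then have "r x / P x \<le> 1"
    by (rule tendsto_lowerbound) (use bound in auto)
  then show ?thesis using P[of x] by (simp add: r_def P_def)
qed

section \<open>Consecutive dimensions\<close>

lemma gamma_const_altdef:
  fixes d :: nat
  assumes "d \<ge> 2"
  shows "gamma_const d = 2 ^ d * (Gamma (real d / 2 + 1))\<^sup>2 / Bessel_J_first_zero ((real d - 2) / 2) ^ d"
proof -
  have "real d / 2 \<notin> \<int>\<^sub>\<le>\<^sub>0" using assms by (auto dest: nonpos_Ints_nonpos)
  then have "Gamma (real d / 2 + 1) = real d / 2 * Gamma (real d / 2)" by (rule Gamma_plus1)
  moreover have "(2::real) ^ d = 2 ^ (d - 2) * 4"
    using assms by (subst le_add_diff_inverse2[of 2 d, symmetric]) (simp_all only: power_add, simp)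
  ultimately show ?thesis
    by (simp only: gamma_const_def power_mult_distrib power_divide) simp
qed

text \<open>
  With \<open>x = d/2 + 1\<close> the upper bound \<open>4 (x\<^sup>2 - x/2 + 1/8)\<close> for \<open>4 (\<Gamma>(x + 1/2) / \<Gamma>(x))\<^sup>4\<close> is
  \<open>d\<^sup>2 + 3d + 5/2\<close>.
\<close>

lemma gamma_const_step:
  fixes d :: nat
  assumes "d \<ge> 2"
    and key: "((real d)\<^sup>2 + 3 * real d + 5 / 2) * ((Bessel_J_first_zero ((real d - 2) / 2))\<^sup>2) ^ d
                \<le> ((Bessel_J_first_zero ((real d - 1) / 2))\<^sup>2) ^ (d + 1)"
  shows "gamma_const (d + 1) \<le> gamma_const d"
proof -
  define j where "j = Bessel_J_first_zero ((real d - 2) / 2)"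
  define j' where "j' = Bessel_J_first_zero ((real d - 1) / 2)"
  define x where "x = real d / 2 + 1"
  define G where "G = Gamma x"
  define H where "H = Gamma (x + 1 / 2)"
  have j: "j > 0" "j' > 0"
    using assms by (auto simp: j_def j'_def intro!: Bessel_J_first_zero_pos)
  have G: "G > 0" "H > 0" using assms by (auto simp: G_def H_def x_def)
  have "(H / G) ^ 4 \<le> x\<^sup>2 - x / 2 + 1 / 8"
    unfolding G_def H_def by (rule Gamma_quotient_power4_le) (simp add: x_def add_nonneg_pos)
  also have "\<dots> = ((real d)\<^sup>2 + 3 * real d + 5 / 2) / 4"
    by (simp add: x_def power2_eq_square field_simps)
  finally have "4 * (H / G) ^ 4 * (j\<^sup>2) ^ d \<le> ((real d)\<^sup>2 + 3 * real d + 5 / 2) * (j\<^sup>2) ^ d"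
    by (intro mult_right_mono) auto
  also have "\<dots> \<le> (j'\<^sup>2) ^ (d + 1)" using key by (simp only: j_def j'_def)
  finally have "4 * (H / G) ^ 4 * (j\<^sup>2) ^ d \<le> (j'\<^sup>2) ^ (d + 1)" .
  then have "(2 * (H / G)\<^sup>2 * j ^ d)\<^sup>2 \<le> (j' ^ (d + 1))\<^sup>2"
    by (simp add: power_mult_distrib flip: power_mult) (simp add: power_mult mult.commute)
  then have "2 * (H / G)\<^sup>2 * j ^ d \<le> j' ^ (d + 1)"
    by (rule power2_le_imp_le) (use j in simp)
  then have main: "2 * H\<^sup>2 * j ^ d \<le> j' ^ (d + 1) * G\<^sup>2"
    using G by (simp add: power_divide divide_le_eq del: power_Suc)
  have "gamma_const (d + 1) = 2 ^ (d + 1) * H\<^sup>2 / j' ^ (d + 1)"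
    using gamma_const_altdef[of "d + 1"] assms
    by (simp add: H_def j'_def x_def add_divide_distrib add_ac del: power_Suc)
  also have "\<dots> \<le> 2 ^ d * G\<^sup>2 / j ^ d"
  proof -
    have "2 ^ d * (2 * H\<^sup>2 * j ^ d) \<le> 2 ^ d * (j' ^ (d + 1) * G\<^sup>2)"
      using main by (intro mult_left_mono) auto
    then have "(2 ^ (d + 1) * H\<^sup>2) * j ^ d \<le> (2 ^ d * G\<^sup>2) * j' ^ (d + 1)"
      by (simp add: mult_ac)
    then show ?thesis using j by (simp add: frac_le_eq divide_le_eq pos_le_divide_eq mult_ac del: power_Suc)
  qed
  also have "\<dots> = gamma_const d"
    using gamma_const_altdef[OF assms(1)] by (simp add: G_def x_def j_def)
  finally show ?thesis .
qed

text \<open>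
  Shifting both variables to their least values, \<open>d = 4 + e\<close> and \<open>r = (d + 5)/3 + s\<close>, turns the
  difference of the two sides into a polynomial in \<open>e\<close> and \<open>s\<close> without negative coefficients.
\<close>

lemma first_zero_polynomial_ineq:
  fixes d r :: real
  assumes "d \<ge> 4" "r \<ge> (d + 5) / 3"
  defines "a \<equiv> (2 * d - 3) / 4" and "N \<equiv> (2 * d\<^sup>2 - 2 * d - 1) / 4"
  shows "((d + 8 / 5) / 2 - 11 / 36 * r) * (2 * r\<^sup>2 * (r\<^sup>2 + N) + 3 * a * (r\<^sup>2 + a))
           \<le> (d + 1) * (3 * a * (r\<^sup>2 + a)) * r"
proof -
  define e where "e = d - 4"
  define s where "s = r - (d + 5) / 3"
  have es: "e \<ge> 0" "s \<ge> 0" using assms by (auto simp: e_def s_def)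
  have d: "d = e + 4" and r: "r = s + e / 3 + 3" by (simp_all add: e_def s_def field_simps)
  have "(d + 1) * (3 * a * (r\<^sup>2 + a)) * r
      - ((d + 8 / 5) / 2 - 11 / 36 * r) * (2 * r\<^sup>2 * (r\<^sup>2 + N) + 3 * a * (r\<^sup>2 + a))
    = 1327 / 320 + 8339 / 192 * s ^ 1 + 2447 / 80 * s ^ 2 + 8071 / 720 * s ^ 3
        + 107 / 30 * s ^ 4 + 11 / 18 * s ^ 5 + 246049 / 2880 * e ^ 1
        + 1223 / 10 * e ^ 1 * s ^ 1 + 7259 / 144 * e ^ 1 * s ^ 2 + 2377 / 360 * e ^ 1 * s ^ 3
        + 1 / 54 * e ^ 1 * s ^ 4 + 15077 / 360 * e ^ 2 + 47573 / 1080 * e ^ 2 * s ^ 1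
        + 537 / 40 * e ^ 2 * s ^ 2 + 373 / 324 * e ^ 2 * s ^ 3 + 66797 / 9720 * e ^ 3
        + 16289 / 3240 * e ^ 3 * s ^ 1 + 841 / 972 * e ^ 3 * s ^ 2 + 3739 / 9720 * e ^ 4
        + 461 / 2916 * e ^ 4 * s ^ 1 + 13 / 8748 * e ^ 5"
    unfolding a_def N_def d r by (simp add: eval_nat_numeral field_simps)
  also have "\<dots> \<ge> 0"
    using es by (intro add_nonneg_nonneg mult_nonneg_nonneg) auto
  finally show ?thesis by linarith
qed

text \<open>
  Here \<open>r\<close> is the first zero in dimension \<open>d\<close>, and \<open>r\<^sup>2 (1 + U/V)\<close> is the lower bound for the square of
  the next one.  As \<open>(d + 8/5)\<^sup>2\<close> exceeds \<open>d\<^sup>2 + 3d + 5/2\<close>, it is enough that \<open>(1 + U/V)\<^sup>d\<^sup>+\<^sup>1 \<ge> \<sigma>\<^sup>2\<close> for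
  \<open>\<sigma> = (d + 8/5)/r\<close>.  Since \<open>ln (1 + u) \<ge> 2u/(2 + u)\<close>, this follows from a rational inequality once
  \<open>ln \<sigma>\<close> has been replaced by a linear upper bound.
\<close>

lemma first_zero_power_step_ge_4:
  fixes d :: nat
  assumes "d \<ge> 4"
  shows "((real d)\<^sup>2 + 3 * real d + 5 / 2) * ((Bessel_J_first_zero ((real d - 2) / 2))\<^sup>2) ^ d
           \<le> ((Bessel_J_first_zero ((real d - 1) / 2))\<^sup>2) ^ (d + 1)"
proof -
  define r where "r = Bessel_J_first_zero ((real d - 2) / 2)"
  define Y' where "Y' = (Bessel_J_first_zero ((real d - 1) / 2))\<^sup>2"
  define a where "a = (2 * real d - 3) / 4"
  define N where "N = (2 * (real d)\<^sup>2 - 2 * real d - 1) / 4"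
  have d: "real d \<ge> 4" using assms by simp
  have r0: "r > 0" using d by (auto simp: r_def intro!: Bessel_J_first_zero_pos)
  \<comment> \<open>A linear lower bound implied by both \<open>r\<^sup>2 \<ge> 3d\<close> and \<open>r \<ge> (d - 2)/2\<close> in their respective ranges;
    it makes the final inequality polynomial in \<open>r\<close> and \<open>d\<close>.\<close>
  have rlow: "r \<ge> (real d + 5) / 3"
  proof (cases "d \<le> 15")
    case True
    have "(real d - 4) * (15 - real d) \<ge> 0" using d True by (intro mult_nonneg_nonneg) auto
    then have "((real d + 5) / 3)\<^sup>2 \<le> 3 * real d"
      using True by (simp add: power2_eq_square field_simps)
    also have "\<dots> \<le> r\<^sup>2"
      using Bessel_J_first_zero_square_lower[of "(real d - 2) / 2"] d by (simp add: r_def field_simps)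
    finally show ?thesis by (rule power2_le_imp_le) (use r0 in simp)
  next
    case False
    then have "(real d + 5) / 3 \<le> (real d - 2) / 2" by simp
    also have "\<dots> \<le> r" unfolding r_def using d by (intro order_le_Bessel_J_first_zero) simp
    finally show ?thesis .
  qed
  have a: "a > 0" using d by (simp add: a_def)
  have N: "N > 0"
  proof -
    define w where "w = real d * (real d - 4)"
    have "N = w / 2 + (6 * real d - 1) / 4"
      by (simp add: N_def w_def power2_eq_square field_simps)
    moreover have "w / 2 \<ge> 0" unfolding w_def using d by simp
    moreover have "(6 * real d - 1) / 4 > 0" using d by simp
    ultimately show ?thesis by (simp only: add_nonneg_pos)
  qed
  define U where "U = 3 * a * (r\<^sup>2 + a)"
  define V where "V = r\<^sup>2 * (r\<^sup>2 + N)"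
  have UV: "U > 0" "V > 0" using a N r0 by (auto simp: U_def V_def intro!: mult_pos_pos add_pos_pos)
  have Y': "Y' \<ge> r\<^sup>2 * (1 + U / V)"
  proof -
    have "Y' \<ge> r\<^sup>2 + 3 * (((real d - 1) / 2)\<^sup>2 - ((real d - 2) / 2)\<^sup>2) *
          (r\<^sup>2 + (((real d - 1) / 2)\<^sup>2 - ((real d - 2) / 2)\<^sup>2)) /
          (r\<^sup>2 + 3 * ((real d - 1) / 2)\<^sup>2 - ((real d - 2) / 2)\<^sup>2)"
      unfolding Y'_def r_def using d by (intro Bessel_J_first_zero_square_increment) auto
    moreover have "((real d - 1) / 2)\<^sup>2 - ((real d - 2) / 2)\<^sup>2 = a"
      by (simp add: a_def power2_eq_square field_simps)
    moreover have "r\<^sup>2 + 3 * ((real d - 1) / 2)\<^sup>2 - ((real d - 2) / 2)\<^sup>2 = r\<^sup>2 + N"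
      by (simp add: N_def power2_eq_square field_simps)
    moreover have "r\<^sup>2 * (U / V) = 3 * a * (r\<^sup>2 + a) / (r\<^sup>2 + N)"
      using r0 by (simp add: U_def V_def)
    ultimately show ?thesis by (simp add: distrib_left)
  qed
  define \<sigma> where "\<sigma> = (real d + 8 / 5) / r"
  have \<sigma>: "\<sigma> > 0" using r0 by (simp add: \<sigma>_def add_nonneg_pos)
  \<comment> \<open>The tangent of \<open>ln\<close> at \<open>2\<close>: for large \<open>d\<close> the bound \<open>r \<ge> (d - 2)/2\<close> keeps \<open>\<sigma>\<close> below about \<open>2\<close>, and the
    margin is smallest at that end.\<close>
  have "ln \<sigma> = ln 2 + ln (\<sigma> / 2)" using \<sigma> by (simp add: ln_div)
  also have "\<dots> \<le> 25 / 36 + (\<sigma> / 2 - 1)"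
    using \<sigma> ln2_le_25_over_36 by (intro add_mono ln_le_minus_one) auto
  also have "\<dots> \<le> (real d + 1) * (U / (2 * V + U))"
  proof -
    have "((real d + 8 / 5) / 2 - 11 / 36 * r) * (2 * V + U) \<le> (real d + 1) * U * r"
      using first_zero_polynomial_ineq[OF d rlow] by (simp add: U_def V_def a_def N_def mult_ac)
    moreover have "(real d + 8 / 5) / 2 - 11 / 36 * r = (\<sigma> / 2 - 11 / 36) * r"
      using r0 by (simp add: \<sigma>_def left_diff_distrib)
    ultimately have "((\<sigma> / 2 - 11 / 36) * (2 * V + U)) * r \<le> ((real d + 1) * U) * r"
      by (simp only: mult_ac)
    then have "(\<sigma> / 2 - 11 / 36) * (2 * V + U) \<le> (real d + 1) * U"
      using r0 by simp
    then show ?thesis using UV by (simp add: pos_le_divide_eq)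
  qed
  also have "\<dots> \<le> (real d + 1) * (ln (1 + U / V) / 2)"
  proof (rule mult_left_mono)
    have "ln (1 + U / V) - ln 1 \<ge> 2 * (1 + U / V - 1) / (1 + (1 + U / V))"
      using UV by (intro ln_inverse_approx_ge) auto
    also have "2 * (1 + U / V - 1) / (1 + (1 + U / V)) = 2 * (U / (2 * V + U))"
      using UV by (simp add: field_simps)
    finally show "U / (2 * V + U) \<le> ln (1 + U / V) / 2" by (simp add: mult.commute)
  qed simp
  finally have "2 * ln \<sigma> \<le> (real d + 1) * ln (1 + U / V)" by simp
  moreover have "1 + U / V > 0" using UV by (simp add: add_pos_pos)
  ultimately have "ln (\<sigma>\<^sup>2) \<le> ln ((1 + U / V) ^ (d + 1))"
    using \<sigma> by (simp add: ln_realpow add_ac del: power_Suc)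
  then have pow: "\<sigma>\<^sup>2 \<le> (1 + U / V) ^ (d + 1)"
    using \<sigma> \<open>1 + U / V > 0\<close> by (simp del: power_Suc)
  have "((real d)\<^sup>2 + 3 * real d + 5 / 2) * (r\<^sup>2) ^ d \<le> (real d + 8 / 5)\<^sup>2 * (r\<^sup>2) ^ d"
    using d by (intro mult_right_mono) (auto simp: power2_eq_square algebra_simps)
  also have "\<dots> = \<sigma>\<^sup>2 * (r\<^sup>2) ^ (d + 1)"
    using r0 by (simp add: \<sigma>_def power_divide)
  also have "\<dots> \<le> (1 + U / V) ^ (d + 1) * (r\<^sup>2) ^ (d + 1)"
    using pow by (intro mult_right_mono) auto
  also have "\<dots> = (r\<^sup>2 * (1 + U / V)) ^ (d + 1)"
    by (simp only: power_mult_distrib mult.commute)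
  also have "\<dots> \<le> Y' ^ (d + 1)"
    using Y' UV by (intro power_mono) auto
  finally show ?thesis by (simp only: r_def Y'_def)
qed

text \<open>
  In dimensions 2 and 3 the quartic truncation at the chosen \<open>z\<close> is negative, which bounds the smaller
  zero from above; the general lower bound serves for the larger one.  Both choices of \<open>z\<close> lie just
  beyond \<open>j\<^sup>2/4\<close>, whose values are approximately \<open>1.446\<close> for order \<open>0\<close> and \<open>\<pi>\<^sup>2/4 \<approx> 2.467\<close> for order
  \<open>1/2\<close>.
\<close>

lemma first_zero_power_step_2:
  "25 / 2 * ((Bessel_J_first_zero 0)\<^sup>2) ^ 2 \<le> ((Bessel_J_first_zero (1 / 2))\<^sup>2) ^ 3"
proof -
  have "(Bessel_J_first_zero 0)\<^sup>2 \<le> 4 * (3 / 2)"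
    by (rule Bessel_J_first_zero_square_upper) (simp_all add: eval_nat_numeral)
  then have "25 / 2 * ((Bessel_J_first_zero 0)\<^sup>2) ^ 2 \<le> 25 / 2 * (4 * (3 / 2)) ^ 2"
    by (intro mult_left_mono power_mono) auto
  also have "\<dots> \<le> (6 * (1 / 2 + 1)) ^ 3" by (simp add: eval_nat_numeral)
  also have "\<dots> \<le> ((Bessel_J_first_zero (1 / 2))\<^sup>2) ^ 3"
    using Bessel_J_first_zero_square_lower[of "1 / 2"] by (intro power_mono) auto
  finally show ?thesis .
qed

lemma first_zero_power_step_3:
  "41 / 2 * ((Bessel_J_first_zero (1 / 2))\<^sup>2) ^ 3 \<le> ((Bessel_J_first_zero 1)\<^sup>2) ^ 4"
proof -
  have "(Bessel_J_first_zero (1 / 2))\<^sup>2 \<le> 4 * (5 / 2)"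
    by (rule Bessel_J_first_zero_square_upper) (simp_all add: eval_nat_numeral)
  then have "41 / 2 * ((Bessel_J_first_zero (1 / 2))\<^sup>2) ^ 3 \<le> 41 / 2 * (4 * (5 / 2)) ^ 3"
    by (intro mult_left_mono power_mono) auto
  also have "\<dots> \<le> (6 * (1 + 1)) ^ 4" by (simp add: eval_nat_numeral)
  also have "\<dots> \<le> ((Bessel_J_first_zero 1)\<^sup>2) ^ 4"
    using Bessel_J_first_zero_square_lower[of 1] by (intro power_mono) auto
  finally show ?thesis .
qed

theorem theorem5p1:
  fixes d :: nat
  assumes "d \<ge> 2"
  shows "gamma_const (d + 1) \<le> gamma_const d"
proof (rule gamma_const_step[OF assms])
  consider "d = 2" | "d = 3" | "d \<ge> 4" using assms by linarith
  then show "((real d)\<^sup>2 + 3 * real d + 5 / 2) * ((Bessel_J_first_zero ((real d - 2) / 2))\<^sup>2) ^ d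
      \<le> ((Bessel_J_first_zero ((real d - 1) / 2))\<^sup>2) ^ (d + 1)"
  proof cases
    case 1
    then show ?thesis using first_zero_power_step_2 by simp
  next
    case 2
    then show ?thesis using first_zero_power_step_3 by simp
  next
    case 3
    then show ?thesis by (rule first_zero_power_step_ge_4)
  qed
qed

end
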